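(* Let $F(t)=-t^2$ and $G(t)=t^3-1$. Let $f,g\in\mathbb{Q}[t]$ with $\deg f=2$, $\deg g=3$. Then $g$ divides $f^3+1$ and $f$ divides $g^3+1$ in $\mathbb{Q}[t]$ if and only if there exist $\alpha\in\mathbb{Q}\setminus\{0\}$ and $\beta\in\mathbb{Q}$ such that $f(t)=F(\alpha t+\beta)$ and $g(t)=G(\alpha t+\beta)$.
   Context: Solutions are considered up to affine reparametrization $t\mapsto\alpha t+\beta$ ($\alpha\in\mathbb{Q}\setminus\{0\}$, $\beta\in\mathbb{Q}$). (Since $\gcd(2,3)=1$, no such pair is a composition $f=f_1\circ h$, $g=g_1\circ h$ with $\deg h\ge 2$.) *)

theory Defs
  imports "HOL-Computational_Algebra.Polynomial"
begin

definition F :: "rat poly" where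
  "F = - (monom 1 2)"

definition G :: "rat poly" where
  "G = monom 1 3 - 1"

end

theory Submission
  imports Defs "HOL-Computational_Algebra.Polynomial_Factorial"
    "HOL-Computational_Algebra.Field_as_Ring"
begin

text \<open>
  Factor \<open>p\<^sup>3 + 1 = (p + 1) (p\<^sup>2 - p + 1)\<close>. Since \<open>x\<^sup>2 - x + 1\<close> has no rational root, the
  second factor has no linear divisor over the rationals. By degrees, \<open>g = l h\<close> with \<open>l\<close> linear,
  \<open>l\<close> dividing \<open>f + 1\<close>, and \<open>h\<close> quadratic, dividing \<open>f\<^sup>2 - f + 1\<close>. The remainder \<open>e\<close> of \<open>f\<close>
  modulo \<open>h\<close> is then linear and \<open>h\<close> is proportional to \<open>e\<^sup>2 - e + 1\<close>. Taking \<open>e\<close> as the new variable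
  \<open>t\<close> gives \<open>f = t + k (t\<^sup>2 - t + 1)\<close> and \<open>g = c (t - r) (t\<^sup>2 - t + 1)\<close> with \<open>f(r) = -1\<close>.
  In the same way \<open>f\<close> divides \<open>g + 1\<close> or \<open>g\<^sup>2 - g + 1\<close>. The first case forces
  \<open>k = -1\<close>, \<open>r = 2\<close>, \<open>c = 1\<close>, which is the known solution in \<open>t - 1\<close>; the second makes \<open>r\<close> a root of
  a monic sextic over the integers that has no root modulo 2.
\<close>

section \<open>Two polynomials without rational roots\<close>

lemma no_rat_root_sq_minus_self_plus_one:
  fixes x :: rat
  shows "x\<^sup>2 - x + 1 \<noteq> 0"
proof -
  have "x\<^sup>2 - x + 1 = (x - 1/2)\<^sup>2 + 3/4"
    by (simp add: power2_eq_square algebra_simps)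
  also have "\<dots> > 0"
    by (rule add_nonneg_pos) simp_all
  finally show ?thesis by simp
qed

text \<open>The sextic is what remains in \<open>solution_in_normal_form\<close> once everything but
  \<open>r\<close> is eliminated in the second case.\<close>

lemma no_rat_root_sextic:
  fixes r :: rat
  shows "r^6 - r^5 + 10 * r^4 - 5 * r^3 + 35 * r\<^sup>2 - 26 * r + 3 \<noteq> 0"
proof
  assume eq: "r^6 - r^5 + 10 * r^4 - 5 * r^3 + 35 * r\<^sup>2 - 26 * r + 3 = 0"
  obtain a b where r: "r = Rat.Fract a b" and b: "b > 0" and ab: "coprime a b"
    by (cases r) auto
  have r': "r * of_int b = of_int a"
    using r b by (simp add: Fract_of_int_quotient)
  have "(of_int (a^6 - a^5*b + 10*a^4*b^2 - 5*a^3*b^3 + 35*a^2*b^4 - 26*a*b^5 + 3*b^6) :: rat)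
      = (r^6 - r^5 + 10 * r^4 - 5 * r^3 + 35 * r\<^sup>2 - 26 * r + 3) * of_int b ^ 6"
    unfolding of_int_add of_int_diff of_int_mult of_int_power r'[symmetric]
    by (simp add: algebra_simps power_numeral_reduce)
  then have "a^6 - a^5*b + 10*a^4*b^2 - 5*a^3*b^3 + 35*a^2*b^4 - 26*a*b^5 + 3*b^6 = 0"
    unfolding eq mult_zero_left of_int_eq_0_iff .
  then have "even (a^6 - a^5*b + 10*a^4*b^2 - 5*a^3*b^3 + 35*a^2*b^4 - 26*a*b^5 + 3*b^6)"
    by simp
  \<comment> \<open>Modulo 2 the form is \<open>a^6 + a^5*b + a^3*b^3 + a^2*b^4 + b^6\<close>, which
    is odd as soon as \<open>a\<close> or \<open>b\<close> is odd.\<close>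
  then have "even a \<and> even b" by auto
  with ab show False
    using coprime_common_divisor by fastforce
qed

section \<open>Divisors and degree of \<open>p\<^sup>2 - p + 1\<close>\<close>

lemma degree_1_poly_rootE:
  fixes p :: "'a::field poly"
  assumes "degree p = 1"
  obtains a r where "a \<noteq> 0" "p = smult a [:- r, 1:]"
proof -
  define a where "a = coeff p 1"
  have "a \<noteq> 0"
    using assms by (metis a_def degree_0 leading_coeff_0_iff zero_neq_one)
  moreover have "p = smult a [:- (- coeff p 0 / a), 1:]"
  proof (rule poly_eqI)
    fix n
    show "coeff p n = coeff (smult a [:- (- coeff p 0 / a), 1:]) n"
      using assms \<open>a \<noteq> 0\<close>
      by (cases "n \<le> 1") (auto simp: a_def le_Suc_eq coeff_eq_0 coeff_pCons split: nat.split)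
  qed
  ultimately show ?thesis by (rule that)
qed

lemma dvd_sq_minus_self_plus_one_degree_neq_1:
  fixes d p :: "rat poly"
  assumes "d dvd p\<^sup>2 - p + 1"
  shows "degree d \<noteq> 1"
proof
  assume "degree d = 1"
  then obtain a r where "d = smult a [:- r, 1:]"
    by (rule degree_1_poly_rootE)
  then have "poly d r = 0" by simp
  with assms have "poly (p\<^sup>2 - p + 1) r = 0"
    by (metis dvdE mult_zero_left poly_mult)
  then show False
    using no_rat_root_sq_minus_self_plus_one[of "poly p r"] by simp
qed

lemma degree_sq_minus_self_plus_one:
  fixes p :: "rat poly"
  shows "degree (p\<^sup>2 - p + 1) = 2 * degree p"
proof (cases "degree p = 0")
  case True
  then show ?thesis
    by (elim degree_eq_zeroE) (simp add: power2_eq_square one_pCons)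
next
  case False
  then have "p \<noteq> 0" by auto
  then have "degree (p\<^sup>2) = 2 * degree p"
    by (simp add: degree_power_eq)
  moreover have "degree (- p + 1) \<le> degree p"
    by (intro degree_add_le) auto
  ultimately have "degree (p\<^sup>2 + (- p + 1)) = 2 * degree p"
    using False by (subst degree_add_eq_left) auto
  then show ?thesis by (simp add: algebra_simps)
qed

lemma sq_minus_self_plus_one_neq_0:
  fixes p :: "rat poly"
  shows "p\<^sup>2 - p + 1 \<noteq> 0"
  using no_rat_root_sq_minus_self_plus_one[of "poly p 0"]
  by (metis poly_0 poly_1 poly_add poly_diff poly_power)

section \<open>Splitting the divisors of \<open>p^3 + 1\<close>\<close>

lemma cube_plus_one_factor:
  fixes p :: "'a::comm_ring_1"
  shows "p^3 + 1 = (p + 1) * (p\<^sup>2 - p + 1)"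
  by (simp add: algebra_simps power_numeral_reduce)

lemma cubic_dvd_quadratic_cube_plus_oneE:
  fixes f g :: "rat poly"
  assumes f: "degree f = 2" and g: "degree g = 3" and dvd: "g dvd f^3 + 1"
  obtains l h where "g = l * h" "degree l = 1" "degree h = 2" "l dvd f + 1" "h dvd f\<^sup>2 - f + 1"
proof -
  from dvd have "g dvd (f + 1) * (f\<^sup>2 - f + 1)"
    by (simp add: cube_plus_one_factor)
  from division_decomp[OF this] obtain l h
    where lh: "g = l * h" "l dvd f + 1" "h dvd f\<^sup>2 - f + 1"
    by (elim exE conjE)
  have g0: "g \<noteq> 0" using g by auto
  then have sum: "degree l + degree h = 3"
    using g lh(1) by (metis degree_mult_eq mult_eq_0_iff)
  have f1: "degree (f + 1) = 2"
    using f by (subst degree_add_eq_left) auto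
  then have "degree l \<le> 2"
    using lh(2) by (metis dvd_imp_degree_le degree_0 zero_neq_numeral)
  moreover have "degree h \<noteq> 1"
    using lh(3) by (rule dvd_sq_minus_self_plus_one_degree_neq_1)
  \<comment> \<open>Otherwise the cofactor of \<open>h\<close> in the quartic
    \<open>f\<^sup>2 - f + 1\<close> would be linear.\<close>
  moreover have "degree h \<noteq> 3"
  proof
    assume h: "degree h = 3"
    obtain k where k: "f\<^sup>2 - f + 1 = h * k"
      using lh(3) by (elim dvdE)
    then have "degree h + degree k = 4"
      using degree_sq_minus_self_plus_one[of f] sq_minus_self_plus_one_neq_0[of f] f
      by (metis degree_mult_eq mult_eq_0_iff mult_2 numeral_Bit0)
    with h have "degree k = 1" by simp
    moreover have "k dvd f\<^sup>2 - f + 1" using k by simp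
    ultimately show False
      using dvd_sq_minus_self_plus_one_degree_neq_1 by blast
  qed
  ultimately have "degree l = 1" "degree h = 2"
    using sum by linarith+
  with lh that show thesis by blast
qed

lemma quadratic_dvd_cube_plus_one:
  fixes f g :: "rat poly"
  assumes f: "degree f = 2" and dvd: "f dvd g^3 + 1"
  shows "f dvd g + 1 \<or> f dvd g\<^sup>2 - g + 1"
proof -
  from dvd have "f dvd (g + 1) * (g\<^sup>2 - g + 1)"
    by (simp add: cube_plus_one_factor)
  from division_decomp[OF this] obtain u v
    where uv: "f = u * v" "u dvd g + 1" "v dvd g\<^sup>2 - g + 1"
    by (elim exE conjE)
  have f0: "f \<noteq> 0" using f by auto
  then have nz: "u \<noteq> 0" "v \<noteq> 0" using uv(1) by auto
  then have sum: "degree u + degree v = 2"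
    using f uv(1) by (simp add: degree_mult_eq)
  have "degree v \<noteq> 1"
    using uv(3) by (rule dvd_sq_minus_self_plus_one_degree_neq_1)
  \<comment> \<open>The degrees add up to 2 and \<open>v\<close> is not linear, so one of the two
    factors is a unit.\<close>
  then consider "degree v = 0" | "degree u = 0"
    using sum by linarith
  then show ?thesis
  proof cases
    case 1
    then have "is_unit v" using nz by (simp add: is_unit_iff_degree)
    then show ?thesis using uv by (simp add: mult_unit_dvd_iff)
  next
    case 2
    then have "is_unit u" using nz by (simp add: is_unit_iff_degree)
    then show ?thesis using uv by (simp add: mult_unit_dvd_iff')
  qed
qed

section \<open>Normal form of the pair\<close>

lemma quadratic_dvd_sq_minus_self_plus_oneE:
  fixes f h :: "rat poly"
  assumes f: "degree f = 2" and h: "degree h = 2" and dvd: "h dvd f\<^sup>2 - f + 1"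
  obtains e c k where "degree e = 1" "c \<noteq> 0" "k \<noteq> 0"
    "h = smult c (e\<^sup>2 - e + 1)" "f = e + smult k (e\<^sup>2 - e + 1)"
proof -
  define e where "e = f mod h"
  have h0: "h \<noteq> 0" using h by auto
  have fe: "f = h * (f div h) + e" by (simp add: e_def)
  have e2: "degree e < 2"
    using degree_mod_less[OF h0, of f] h by (auto simp: e_def)
  \<comment> \<open>The difference of the values at \<open>f\<close> and \<open>e\<close> is
    \<open>(f - e) * (f + e - 1)\<close>, and \<open>h\<close> divides \<open>f - e\<close>.\<close>
  have "f\<^sup>2 - f + 1 = (e\<^sup>2 - e + 1) + h * ((f div h) * (f + e - 1))"
  proof -
    have "h * (f div h) = f - e" using fe by (metis add_diff_cancel_right')
    then have "h * ((f div h) * (f + e - 1)) = (f - e) * (f + e - 1)"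
      by (metis mult.assoc)
    then show ?thesis by (simp add: algebra_simps power2_eq_square)
  qed
  with dvd have he: "h dvd e\<^sup>2 - e + 1"
    by (metis dvd_add_left_iff dvd_triv_left)
  have e_le: "2 \<le> 2 * degree e"
    using dvd_imp_degree_le[OF he sq_minus_self_plus_one_neq_0] h
    by (simp add: degree_sq_minus_self_plus_one)
  with e2 have e1: "degree e = 1" by linarith
  obtain m where m: "e\<^sup>2 - e + 1 = h * m" using he by (elim dvdE)
  have "m \<noteq> 0" using m sq_minus_self_plus_one_neq_0[of e] by auto
  then have "degree m = 0"
    using degree_sq_minus_self_plus_one[of e] e1 m h h0 by (simp add: degree_mult_eq)
  then obtain m0 where m0: "m = [:m0:]" by (elim degree_eq_zeroE)
  have m00: "m0 \<noteq> 0" using m0 \<open>m \<noteq> 0\<close> by auto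
  have hq: "h = smult (1 / m0) (e\<^sup>2 - e + 1)"
    using m m0 m00 by simp
  have "f div h \<noteq> 0"
    using fe f e1 by (metis add_0 mult_zero_right numeral_eq_one_iff semiring_norm(85))
  moreover have "degree (h * (f div h)) \<le> 2"
  proof -
    have "h * (f div h) = f - e" using fe by (metis add_diff_cancel_right')
    then show ?thesis using f e1 by (simp add: degree_diff_le)
  qed
  ultimately have "degree (f div h) = 0"
    using h h0 by (simp add: degree_mult_eq)
  then obtain k where k: "f div h = [:k:]" by (elim degree_eq_zeroE)
  have "f = e + smult (k / m0) (e\<^sup>2 - e + 1)"
  proof -
    have "f = smult k h + e" using fe k by simp
    also have "\<dots> = smult k (smult (1 / m0) (e\<^sup>2 - e + 1)) + e"
      using hq by simp
    finally show ?thesis by (simp add: add.commute)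
  qed
  moreover have "k / m0 \<noteq> 0" using k \<open>f div h \<noteq> 0\<close> m00 by auto
  ultimately show thesis
    using that[of e "1 / m0" "k / m0"] e1 m00 hq by simp
qed

text \<open>Here \<open>e\<close> has become the variable, and \<open>r\<close> is the root of the
  linear factor of \<open>g\<close>. Reducing \<open>g\<close> modulo \<open>f\<close> turns both
  cases into equations between coefficients.\<close>

lemma solution_in_normal_form:
  fixes c k r :: rat
  defines "f \<equiv> [:k, 1 - k, k:]" and "g \<equiv> smult c ([:- r, 1:] * [:1, -1, 1:])"
  assumes k: "k \<noteq> 0" and r: "poly f r = -1" and dvd: "f dvd g^3 + 1"
  shows "k = -1 \<and> r = 2 \<and> c = 1"
proof -
  have rk: "k * (r\<^sup>2 - r + 1) = - (r + 1)"
    using r by (simp add: f_def algebra_simps power2_eq_square)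
  \<comment> \<open>The remainder of \<open>g\<close> modulo \<open>f\<close> is
    \<open>p + q t\<close>: modulo \<open>f\<close>, \<open>t^2 - t + 1\<close> is
    \<open>- t / k\<close>.\<close>
  define p q where "p = c / k" and "q = (c / k) * (r + (1 - k) / k)"
  have df: "degree f = 2" using k by (simp add: f_def)
  then have f0: "f \<noteq> 0" by auto
  have gf: "g = f * [:- (c / k) * r - c / k\<^sup>2, c / k:] + [:p, q:]"
    using k by (simp add: f_def g_def p_def q_def field_simps power2_eq_square)
  from quadratic_dvd_cube_plus_one[OF df dvd] show ?thesis
  proof
    assume "f dvd g + 1"
    moreover have "g + 1 = f * [:- (c / k) * r - c / k\<^sup>2, c / k:] + ([:p, q:] + 1)"
      using gf by simp
    ultimately have "f dvd [:p, q:] + 1"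
      by (metis dvd_add_right_iff dvd_triv_left)
    then have "f dvd [:p + 1, q:]" by (simp add: one_pCons)
    moreover have "degree [:p + 1, q:] < degree f" using df by simp
    ultimately have "[:p + 1, q:] = 0"
      by (metis dvd_imp_degree_le leD)
    then have pq: "p = -1" "q = 0" by (auto simp: eq_neg_iff_add_eq_0)
    then have c: "c = - k" using k by (simp add: p_def field_simps)
    have "k * r = k - 1"
      using pq(2) c k by (simp add: q_def field_simps)
    \<comment> \<open>Multiplying \<open>rk\<close> by \<open>k\<close> leaves \<open>r\<close> only
      in the product \<open>k * r\<close>, which is known to be \<open>k - 1\<close>.\<close>
    moreover have "(k * r)\<^sup>2 - (k * r) * k + k\<^sup>2 = - (k * r) - k"
      using arg_cong[OF rk, of "\<lambda>x. k * x"] by (simp add: algebra_simps power2_eq_square)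
    ultimately have "k * (k + 1) = 0"
      by algebra
    then have "k = -1" using k by (simp add: eq_neg_iff_add_eq_0)
    then show ?thesis using c \<open>k * r = k - 1\<close> by simp
  next
    let ?x = "[:p, q:]" and ?s = "[:- (c / k) * r - c / k\<^sup>2, c / k:]"
    assume "f dvd g\<^sup>2 - g + 1"
    moreover have "g\<^sup>2 - g + 1 = f * (?s * (g + ?x - 1)) + (?x\<^sup>2 - ?x + 1)"
    proof -
      have "f * ?s = g - ?x" using gf by (metis add_diff_cancel_right')
      then have "f * (?s * (g + ?x - 1)) = (g - ?x) * (g + ?x - 1)"
        by (metis mult.assoc)
      then show ?thesis by (simp only: algebra_simps power2_eq_square)
    qed
    ultimately have "f dvd ?x\<^sup>2 - ?x + 1"
      by (metis dvd_add_right_iff dvd_triv_left)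
    then obtain m where m: "?x\<^sup>2 - ?x + 1 = f * m" by (elim dvdE)
    have "m \<noteq> 0" using m sq_minus_self_plus_one_neq_0[of ?x] by auto
    moreover have "degree (?x\<^sup>2 - ?x + 1) \<le> 2"
      by (simp add: degree_sq_minus_self_plus_one)
    ultimately have "degree m = 0"
      using m df f0 by (simp add: degree_mult_eq)
    then obtain m0 where m0: "m = [:m0:]" by (elim degree_eq_zeroE)
    \<comment> \<open>Coefficients of 1, \<open>t\<close> and \<open>t^2\<close> in the identity;
      \<open>c0\<close> and \<open>c2\<close> together give
      \<open>p\<^sup>2 - p + 1 = q\<^sup>2\<close>.\<close>
    have c0: "p\<^sup>2 - p + 1 = m0 * k" and c1: "(2 * p - 1) * q = m0 * (1 - k)" and c2: "q\<^sup>2 = m0 * k"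
      using m m0 by (auto simp: f_def power2_eq_square one_pCons algebra_simps)
    have N: "r\<^sup>2 - r + 1 \<noteq> 0" by (rule no_rat_root_sq_minus_self_plus_one)
    have r1: "r + 1 \<noteq> 0" using k rk N by (metis mult_eq_0_iff neg_0_equal_iff_equal)
    have inv_k: "1 / k = - (r\<^sup>2 - r + 1) / (r + 1)"
      using rk k r1 by (simp add: field_simps)
    \<comment> \<open>These express \<open>r + (1 - k) / k\<close> and \<open>(1 - k) / k\<close>
      through \<open>r\<close> alone, using \<open>inv_k\<close>.\<close>
    define n w where "n = (r - 2) / (r + 1)" and "w = - (r\<^sup>2 + 2) / (r + 1)"
    have w: "(1 - k) / k = w"
      using inv_k k r1 by (simp add: w_def diff_divide_distrib) (simp add: field_simps)
    have qn: "q = p * n"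
      unfolding q_def w p_def[symmetric]
      using r1 by (simp add: w_def n_def field_simps power2_eq_square)
    have "q \<noteq> 0"
      using c0 c2 no_rat_root_sq_minus_self_plus_one[of p] by auto
    have "(2 * p - 1) * q = w * q * q"
    proof -
      have "1 - k = w * k" using w k by (simp add: field_simps)
      with c1 c2 show ?thesis by algebra
    qed
    then have "2 * p - 1 = w * q" using \<open>q \<noteq> 0\<close> by simp
    then have pW: "p * (2 - w * n) = 1" using qn by (simp add: algebra_simps)
    have "p\<^sup>2 - p + 1 = p\<^sup>2 * n\<^sup>2"
      using c0 c2 qn by (simp add: power_mult_distrib)
    \<comment> \<open>Multiplication by \<open>(2 - w * n)\<^sup>2\<close> makes \<open>p\<close>
      occur only in a product that equals 1 by \<open>pW\<close>.\<close>
    then have "(p * (2 - w * n))\<^sup>2 - (p * (2 - w * n)) * (2 - w * n) + (2 - w * n)\<^sup>2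
        = (p * (2 - w * n))\<^sup>2 * n\<^sup>2"
      by algebra
    then have E: "1 - (2 - w * n) + (2 - w * n)\<^sup>2 - n\<^sup>2 = 0"
      unfolding pW by simp
    have nr: "n * (r + 1) = r - 2" and wr: "w * (r + 1) = - (r\<^sup>2 + 2)"
      using r1 by (simp_all add: n_def w_def)
    have "r^6 - r^5 + 10 * r^4 - 5 * r^3 + 35 * r\<^sup>2 - 26 * r + 3
        = (1 - (2 - w * n) + (2 - w * n)\<^sup>2 - n\<^sup>2) * (r + 1)^4"
      using nr wr by algebra
    with E no_rat_root_sextic[of r] show ?thesis by simp
  qed
qed

section \<open>Change of variable and the equivalence\<close>

theorem theorem2p3:
  fixes f g :: "rat poly"
  assumes "degree f = 2" and "degree g = 3"
  shows "(g dvd f ^ 3 + 1 \<and> f dvd g ^ 3 + 1) \<longleftrightarrow>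
    (\<exists>\<alpha> \<beta> :: rat. \<alpha> \<noteq> 0 \<and> f = pcompose F [:\<beta>, \<alpha>:] \<and> g = pcompose G [:\<beta>, \<alpha>:])"
proof
  assume dvd: "g dvd f ^ 3 + 1 \<and> f dvd g ^ 3 + 1"
  obtain l h where lh: "g = l * h" "degree l = 1" "degree h = 2" "l dvd f + 1" "h dvd f\<^sup>2 - f + 1"
    using cubic_dvd_quadratic_cube_plus_oneE assms dvd by blast
  obtain e c k where e: "degree e = 1" "k \<noteq> 0"
      "h = smult c (e\<^sup>2 - e + 1)" "f = e + smult k (e\<^sup>2 - e + 1)"
    using quadratic_dvd_sq_minus_self_plus_oneE[OF assms(1) lh(3,5)] by metis
  obtain a b where ab: "a \<noteq> 0" "e = smult a [:- b, 1:]"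
    using degree_1_poly_rootE[OF e(1)] by blast
  \<comment> \<open>The inverse of \<open>e\<close> under composition; substituting it turns
    \<open>e\<close> into the variable.\<close>
  define e' where "e' = [:b, 1 / a:]"
  have inv: "pcompose e e' = [:0, 1:]" "pcompose e' e = [:0, 1:]"
    using ab by (simp_all add: e'_def pcompose_pCons)
  have de': "degree e' = 1" using ab by (simp add: e'_def)
  have q: "pcompose (e\<^sup>2 - e + 1) e' = [:1, -1, 1:]"
    by (simp add: pcompose_add pcompose_diff pcompose_mult power2_eq_square inv one_pCons pcompose_pCons)
  obtain d r where dr: "pcompose l e' = smult d [:- r, 1:]"
    using degree_1_poly_rootE[of "pcompose l e'"] lh(2) de' by (metis degree_pcompose mult_1)
  have f0: "pcompose f e' = [:k, 1 - k, k:]"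
    by (subst e(4), subst pcompose_add) (simp add: pcompose_smult inv q)
  have g0: "pcompose g e' = smult (d * c) ([:- r, 1:] * [:1, -1, 1:])"
    unfolding lh(1) e(3) pcompose_mult pcompose_smult q dr by (simp add: algebra_simps)
  have comp_dvd: "pcompose u e' dvd pcompose v e'" if "u dvd v" for u v :: "rat poly"
    using that by (metis dvd_def pcompose_mult)
  have "pcompose l e' dvd pcompose f e' + 1"
    using comp_dvd[OF lh(4)] by (simp add: pcompose_add pcompose_1)
  then have "poly (pcompose f e' + 1) r = 0"
    unfolding dr by (elim dvdE) simp
  then have root: "poly [:k, 1 - k, k:] r = -1"
    unfolding f0 by (simp add: eq_neg_iff_add_eq_0)
  have "pcompose f e' dvd (pcompose g e')^3 + 1"
    using comp_dvd[of f "g^3 + 1"] dvd by (simp add: pcompose_add pcompose_1 pcompose_mult power3_eq_cube)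
  then have sol: "k = -1" "r = 2" "d * c = 1"
    using solution_in_normal_form[OF e(2) root, of "d * c"] unfolding f0 g0 by auto
  have comp_e: "u = pcompose (pcompose u e') e" for u :: "rat poly"
    by (metis inv(2) pcompose_assoc pcompose_idR)
  \<comment> \<open>This is \<open>e - 1\<close>: for \<open>k = -1\<close>, \<open>r = 2\<close>,
    \<open>d * c = 1\<close> the normal forms are \<open>-(t - 1)^2\<close> and
    \<open>(t - 1)^3 - 1\<close>.\<close>
  let ?L = "[:- a * b - 1, a:]"
  have L: "?L = pcompose [:-1, 1:] e"
    using ab by (simp add: pcompose_pCons)
  have "pcompose f e' = pcompose F [:-1, 1:]"
    unfolding f0 sol by (simp add: F_def monom_altdef pcompose_uminus pcompose_mult pcompose_pCons numeral_eq_Suc)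
  then have "f = pcompose F ?L"
    using comp_e[of f] L by (simp add: pcompose_assoc)
  moreover have "pcompose g e' = pcompose G [:-1, 1:]"
    unfolding g0 sol by (simp add: G_def monom_altdef pcompose_diff pcompose_mult pcompose_pCons numeral_eq_Suc one_pCons)
  then have "g = pcompose G ?L"
    using comp_e[of g] L by (simp add: pcompose_assoc)
  ultimately show "\<exists>\<alpha> \<beta> :: rat. \<alpha> \<noteq> 0 \<and> f = pcompose F [:\<beta>, \<alpha>:] \<and> g = pcompose G [:\<beta>, \<alpha>:]"
    using ab by blast
next
  assume "\<exists>\<alpha> \<beta> :: rat. \<alpha> \<noteq> 0 \<and> f = pcompose F [:\<beta>, \<alpha>:] \<and> g = pcompose G [:\<beta>, \<alpha>:]"
  then obtain \<alpha> \<beta> where "f = pcompose F [:\<beta>, \<alpha>:]" "g = pcompose G [:\<beta>, \<alpha>:]"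
    by blast
  then have fg: "f = - ([:\<beta>, \<alpha>:]^2)" "g = [:\<beta>, \<alpha>:]^3 - 1"
    by (simp_all add: F_def G_def monom_altdef pcompose_uminus pcompose_diff pcompose_1 pcompose_mult power3_eq_cube power2_eq_square pcompose_pCons)
  \<comment> \<open>With \<open>s\<close> for the linear polynomial,
    \<open>1 - s^6 = (s^3 - 1) * (-(s^3 + 1))\<close>; below, \<open>(s^3 - 1)^3 + 1\<close> is a
    multiple of \<open>s^3\<close>.\<close>
  have "f^3 + 1 = g * (- ([:\<beta>, \<alpha>:]^3 + 1))"
    unfolding fg by algebra
  moreover have "g^3 + 1 = f * (- [:\<beta>, \<alpha>:] * ([:\<beta>, \<alpha>:]^6 - 3 * [:\<beta>, \<alpha>:]^3 + 3))"
    unfolding fg by algebra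
  ultimately show "g dvd f ^ 3 + 1 \<and> f dvd g ^ 3 + 1"
    by (metis dvd_triv_left)
qed

end
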